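(* Let $R$ be a principal ideal domain and let $I=gR\subsetneq R$ be a proper, non-prime ideal such that $Q:=R/I$ is finite. Suppose that $g=u\cdot p_1^{m_1}p_2^{m_2}$ with $u$ a unit, $p_1,p_2$ non-associated prime elements and integers $m_1,m_2\ge 1$, and let $\bm{m}=(m_1,m_2)$. If $\bm{m}\ne(1,1)$, then the graph $\Gamma_{E'}(Q)$ is isomorphic to the integral covering graph $D(\bm{m})$.
   Context: Rings are commutative and non-zero with $1$. For a ring $Q$, $Z(Q)$ is the set of $r\in Q$ for which there is $s\in Q\setminus\{0\}$ with $rs=0$. The zero divisor graph $\Gamma(Q)$ has vertex set $Z(Q)\setminus\{0\}$; two distinct vertices $r,s$ are adjacent iff $rs=0$. For a graph $G=(V,E)$ with neighbourhoods $N(\cdot)$, define $u\sim' v$ if $N(u)\setminus\{u,v\}=N(v)\setminus\{u,v\}$; this is an equivalence relation, with classes $[v]'$. The graph $G_{E'}$ has vertex set $\{[v]'\colon v\in V\}$ and edge set $\{\{[u]',[v]'\}\colon [u]'\ne[v]' \text{ and } \{u,v\}\in E\}$. $\Gamma_{E'}(Q)$ denotes $G_{E'}$ for $G=\Gamma(Q)$. For $\bm{m}\in\mathbb{Z}_{\ge 1}^n$, the integral covering graph $D(\bm{m})$ has vertex set $\prod_{i=1}^n \{0,1,\dots,m_i\}\setminus\{\bm{0},\bm{m}\}$, and two distinct vertices $\bm v,\bm w$ are adjacent iff $v_i+w_i\ge m_i$ for all $i\in\{1,\dots,n\}$. *)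

theory Defs
  imports "HOL-Algebra.Ring_Divisibility"
begin

text \<open>Undirected simple graphs: edges are two-element sets of vertices.\<close>

record 'a ugraph =
  verts :: "'a set"
  edges :: "'a set set"

definition simple_ugraph :: "'a ugraph \<Rightarrow> bool" where
  "simple_ugraph G \<longleftrightarrow> edges G \<subseteq> {{u, v} |u v. u \<in> verts G \<and> v \<in> verts G \<and> u \<noteq> v}"

definition ugraph_iso :: "'a ugraph \<Rightarrow> 'b ugraph \<Rightarrow> bool" where
  "ugraph_iso G H \<longleftrightarrow> (\<exists>f. bij_betw f (verts G) (verts H) \<and>
     (\<forall>u\<in>verts G. \<forall>v\<in>verts G. {u, v} \<in> edges G \<longleftrightarrow> {f u, f v} \<in> edges H))"

definition nbhd :: "'a ugraph \<Rightarrow> 'a \<Rightarrow> 'a set" where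
  "nbhd G v = {w \<in> verts G. {v, w} \<in> edges G}"

definition twin_rel :: "'a ugraph \<Rightarrow> ('a \<times> 'a) set" where
  "twin_rel G = {(u, v). u \<in> verts G \<and> v \<in> verts G \<and> nbhd G u - {u, v} = nbhd G v - {u, v}}"

definition twin_class :: "'a ugraph \<Rightarrow> 'a \<Rightarrow> 'a set" where
  "twin_class G v = twin_rel G `` {v}"

definition twin_quotient :: "'a ugraph \<Rightarrow> 'a set ugraph" where
  "twin_quotient G =
     \<lparr>verts = {twin_class G v |v. v \<in> verts G},
      edges = {{twin_class G u, twin_class G v} |u v.
        u \<in> verts G \<and> v \<in> verts G \<and> twin_class G u \<noteq> twin_class G v \<and> {u, v} \<in> edges G}\<rparr>"

text \<open>As in the commutative algebra literature, \<open>0\<close> counts as a zero divisor of a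
  non-zero ring.\<close>

definition zero_divs :: "('a, 'b) ring_scheme \<Rightarrow> 'a set" where
  "zero_divs Q = {r \<in> carrier Q. \<exists>s \<in> carrier Q - {\<zero>\<^bsub>Q\<^esub>}. r \<otimes>\<^bsub>Q\<^esub> s = \<zero>\<^bsub>Q\<^esub>}"

definition zero_divisor_graph :: "('a, 'b) ring_scheme \<Rightarrow> 'a ugraph" where
  "zero_divisor_graph Q =
     \<lparr>verts = zero_divs Q - {\<zero>\<^bsub>Q\<^esub>},
      edges = {{r, s} |r s. r \<in> zero_divs Q - {\<zero>\<^bsub>Q\<^esub>} \<and> s \<in> zero_divs Q - {\<zero>\<^bsub>Q\<^esub>} \<and>
        r \<noteq> s \<and> r \<otimes>\<^bsub>Q\<^esub> s = \<zero>\<^bsub>Q\<^esub>}\<rparr>"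

text \<open>A vector in \<open>\<nat>\<^sup>n\<close> is a list of length \<open>n\<close>.\<close>

definition covering_verts :: "nat list \<Rightarrow> nat list set" where
  "covering_verts m =
     {v. length v = length m \<and> (\<forall>i < length m. v ! i \<le> m ! i)} - {replicate (length m) 0, m}"

definition integral_covering_graph :: "nat list \<Rightarrow> nat list ugraph" where
  "integral_covering_graph m =
     \<lparr>verts = covering_verts m,
      edges = {{v, w} |v w. v \<in> covering_verts m \<and> w \<in> covering_verts m \<and> v \<noteq> w \<and>
        (\<forall>i < length m. m ! i \<le> v ! i + w ! i)}\<rparr>"

lemma simple_zero_divisor_graph: "simple_ugraph (zero_divisor_graph Q)"
  by (auto simp: simple_ugraph_def zero_divisor_graph_def)

lemma simple_integral_covering_graph: "simple_ugraph (integral_covering_graph m)"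
  by (auto simp: simple_ugraph_def integral_covering_graph_def)

lemma simple_twin_quotient: "simple_ugraph (twin_quotient G)"
  by (auto simp: simple_ugraph_def twin_quotient_def)

lemma equiv_twin_rel:
  assumes "simple_ugraph G"
  shows "equiv (verts G) (twin_rel G)"
proof (rule equivI)
  show "twin_rel G \<subseteq> verts G \<times> verts G" by (auto simp: twin_rel_def)
  show "refl_on (verts G) (twin_rel G)" by (auto simp: refl_on_def twin_rel_def)
  show "sym (twin_rel G)" by (auto simp: sym_def twin_rel_def insert_commute)
  have adj: "{x, w} \<in> edges G \<longleftrightarrow> {y, w} \<in> edges G"
    if "(x, y) \<in> twin_rel G" "w \<in> verts G" "w \<noteq> x" "w \<noteq> y" for x y w
    using that by (auto simp: twin_rel_def nbhd_def)
  show "trans (twin_rel G)"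
  proof (rule transI)
    fix u v w
    assume uv: "(u, v) \<in> twin_rel G" and vw: "(v, w) \<in> twin_rel G"
    have V: "u \<in> verts G" "v \<in> verts G" "w \<in> verts G"
      using uv vw by (auto simp: twin_rel_def)
    have "{u, x} \<in> edges G \<longleftrightarrow> {w, x} \<in> edges G"
      if x: "x \<in> verts G" "x \<noteq> u" "x \<noteq> w" for x
    proof (cases "x = v")
      case False
      then show ?thesis using adj[OF uv x(1)] adj[OF vw x(1)] x by simp
    next
      case True
      show ?thesis
      proof (cases "u = w")
        case False
        have "{u, v} \<in> edges G \<longleftrightarrow> {u, w} \<in> edges G"
          using adj[OF vw V(1)] x True False by (simp add: insert_commute)
        moreover have "{u, w} \<in> edges G \<longleftrightarrow> {v, w} \<in> edges G"
          using adj[OF uv V(3)] x True False by simp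
        ultimately show ?thesis using True by (simp add: insert_commute)
      qed simp
    qed
    then show "(u, w) \<in> twin_rel G"
      using V by (auto simp: twin_rel_def nbhd_def)
  qed
qed

end

theory Submission
  imports Defs
begin

text \<open>
  Send an element \<open>r\<close> of \<open>Q\<close> to the vector whose \<open>i\<close>-th entry is the multiplicity of \<open>p\<^sub>i\<close>
  in a representative of \<open>r\<close>, capped at \<open>m\<^sub>i\<close>. Since \<open>p\<^sub>i\<close> is prime, \<open>r s = 0\<close> holds iff the two
  vectors sum to at least \<open>(m\<^sub>1, m\<^sub>2)\<close> in every entry, so \<open>\<Gamma>(Q)\<close> is a blow-up of the covering
  graph, and elements with equal vectors are twins. Conversely, for \<open>(m\<^sub>1, m\<^sub>2) \<noteq> (1, 1)\<close>, any two
  vertices of the covering graph are told apart by the adjacency of a third one, so the twin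
  classes are exactly the fibres.
\<close>

section \<open>Twin quotients of blow-ups of a graph\<close>

text \<open>Twins are compared only outside \<open>{u, v}\<close>, so two vertices in one fibre of
  \<open>\<phi>\<close> are twins whether or not they are adjacent to each other. Conversely,
  \<open>sep\<close> yields a vertex that tells two different images apart, and any lift of it tells
  the original vertices apart. The twin classes are therefore the fibres of
  \<open>\<phi>\<close>.\<close>

lemma twin_quotient_iso:
  assumes surj: "\<phi> ` verts G = verts H"
    and edges_G: "\<And>u v. u \<in> verts G \<Longrightarrow> v \<in> verts G \<Longrightarrow>
      {u, v} \<in> edges G \<longleftrightarrow> u \<noteq> v \<and> P (\<phi> u) (\<phi> v)"
    and edges_H: "\<And>x y. x \<in> verts H \<Longrightarrow> y \<in> verts H \<Longrightarrow> {x, y} \<in> edges H \<longleftrightarrow> x \<noteq> y \<and> P x y"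
    and sep: "\<And>x y. x \<in> verts H \<Longrightarrow> y \<in> verts H \<Longrightarrow> x \<noteq> y \<Longrightarrow>
      \<exists>z \<in> verts H - {x, y}. P x z \<noteq> P y z"
  shows "ugraph_iso (twin_quotient G) H"
proof -
  have in_H: "\<phi> u \<in> verts H" if "u \<in> verts G" for u
    using surj that by auto
  have twin: "(u, v) \<in> twin_rel G \<longleftrightarrow> \<phi> u = \<phi> v" if uv: "u \<in> verts G" "v \<in> verts G" for u v
  proof
    assume "\<phi> u = \<phi> v"
    then show "(u, v) \<in> twin_rel G"
      using uv by (auto simp: twin_rel_def nbhd_def edges_G)
  next
    assume tw: "(u, v) \<in> twin_rel G"
    show "\<phi> u = \<phi> v"
    proof (rule ccontr)
      assume "\<phi> u \<noteq> \<phi> v"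
      then obtain z where z: "z \<in> verts H" "z \<noteq> \<phi> u" "z \<noteq> \<phi> v" "P (\<phi> u) z \<noteq> P (\<phi> v) z"
        using sep[OF in_H[OF uv(1)] in_H[OF uv(2)]] by blast
      obtain w where w: "w \<in> verts G" "\<phi> w = z" using z(1) unfolding surj[symmetric] by blast
      \<comment> \<open>Since \<open>z\<close> differs from both images, its lift \<open>w\<close>
        differs from \<open>u\<close> and \<open>v\<close>, so deleting these two vertices does not
        hide the difference in adjacency.\<close>
      have "w \<in> nbhd G u - {u, v} \<longleftrightarrow> w \<in> nbhd G v - {u, v}"
        using tw by (simp add: twin_rel_def)
      then show False using uv w z by (auto simp: nbhd_def edges_G)
    qed
  qed
  have cls: "twin_class G u = {v \<in> verts G. \<phi> v = \<phi> u}" if "u \<in> verts G" for u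
    using that twin by (auto simp: twin_class_def) (auto simp: twin_rel_def)
  have cls_eq: "twin_class G u = twin_class G v \<longleftrightarrow> \<phi> u = \<phi> v"
    if "u \<in> verts G" "v \<in> verts G" for u v
    using that by (auto simp: cls)
  \<comment> \<open>A twin class is a fibre, so its image under \<open>\<phi>\<close> is a
    singleton, and \<open>f\<close> reads off its element without choosing a representative.\<close>
  define f where "f X = the_elem (\<phi> ` X)" for X
  have f: "f (twin_class G u) = \<phi> u" if "u \<in> verts G" for u
  proof -
    have "\<phi> ` twin_class G u = {\<phi> u}" using that by (auto simp: cls)
    then show ?thesis by (simp add: f_def)
  qed
  have edge: "{twin_class G u, twin_class G v} \<in> edges (twin_quotient G) \<longleftrightarrow>
      {\<phi> u, \<phi> v} \<in> edges H" if uv: "u \<in> verts G" "v \<in> verts G" for u v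
  proof
    assume "{twin_class G u, twin_class G v} \<in> edges (twin_quotient G)"
    then obtain a b where ab: "a \<in> verts G" "b \<in> verts G" "twin_class G a \<noteq> twin_class G b"
      "{a, b} \<in> edges G" "{twin_class G u, twin_class G v} = {twin_class G a, twin_class G b}"
      by (auto simp: twin_quotient_def)
    \<comment> \<open>The quotient edge may come from other representatives, and in either order;
      taking the image of the two-element set under \<open>f\<close> handles both at once.\<close>
    have "{\<phi> u, \<phi> v} = {\<phi> a, \<phi> b}"
      using arg_cong[OF ab(5), of "image f"] uv ab(1,2) by (simp add: f)
    moreover have "{\<phi> a, \<phi> b} \<in> edges H"
      using ab(1-4) by (simp add: edges_G edges_H in_H cls_eq)
    ultimately show "{\<phi> u, \<phi> v} \<in> edges H" by simp
  next
    assume "{\<phi> u, \<phi> v} \<in> edges H"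
    then have "\<phi> u \<noteq> \<phi> v" "P (\<phi> u) (\<phi> v)" using uv by (auto simp: edges_H in_H)
    then have "{u, v} \<in> edges G" "twin_class G u \<noteq> twin_class G v"
      using uv by (auto simp: edges_G cls_eq)
    then show "{twin_class G u, twin_class G v} \<in> edges (twin_quotient G)"
      using uv by (auto simp: twin_quotient_def)
  qed
  have V: "verts (twin_quotient G) = twin_class G ` verts G"
    by (auto simp: twin_quotient_def)
  have "bij_betw f (verts (twin_quotient G)) (verts H)"
    unfolding bij_betw_def V
  proof
    show "inj_on f (twin_class G ` verts G)"
      by (auto simp: inj_on_def f cls_eq)
    show "f ` twin_class G ` verts G = verts H"
      by (simp add: surj[symmetric] image_image f)
  qed
  then show ?thesis
    unfolding ugraph_iso_def V by (intro exI[of _ f]) (auto simp: f edge)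
qed

section \<open>Separating vertices of the covering graph\<close>

lemma covering_verts_pair:
  "x \<in> covering_verts [m1, m2] \<longleftrightarrow>
    (\<exists>a b. x = [a, b] \<and> a \<le> m1 \<and> b \<le> m2 \<and> (a, b) \<noteq> (0, 0) \<and> (a, b) \<noteq> (m1, m2))"
  by (auto simp: covering_verts_def length_Suc_conv numeral_2_eq_2 less_Suc_eq)

text \<open>The first candidate is \<open>(m - c, n)\<close>: it covers \<open>m\<close> together
  with \<open>c\<close> but not with the smaller \<open>a\<close>, and its second entry is already
  full. Other witnesses are required only when it coincides with one of the two given
  vectors.\<close>

lemma separating_pair:
  fixes a b c d m n :: nat
  assumes "1 \<le> m" "1 \<le> n" "(m, n) \<noteq> (1, 1)" "a < c" "c \<le> m" "b \<le> n" "d \<le> n"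
    and "(a, b) \<noteq> (0, 0)" "(c, d) \<noteq> (m, n)"
  obtains x y where "x \<le> m" "y \<le> n" "(x, y) \<noteq> (0, 0)" "(x, y) \<noteq> (m, n)"
    "(x, y) \<noteq> (a, b)" "(x, y) \<noteq> (c, d)"
    "(m \<le> a + x \<and> n \<le> b + y) \<noteq> (m \<le> c + x \<and> n \<le> d + y)"
proof -
  obtain k l where m: "m = c + k" and n: "n = Suc l"
    using assms(2,5) le_Suc_ex[of c m] by (cases n) auto
  \<comment> \<open>Here \<open>k\<close> is \<open>m - c\<close> and \<open>l\<close> is
    \<open>n - 1\<close>. If the candidate \<open>(k, n)\<close> is taken and \<open>d\<close> is
    positive, lowering its second entry to \<open>l\<close> still works. If \<open>d = 0\<close>,
    then \<open>b = n\<close>, and \<open>(m, 0)\<close> or \<open>(m, 1)\<close> is compatible with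
    \<open>(a, b)\<close> only. The last case has \<open>n = 1\<close> and the vectors
    \<open>(0, 1)\<close> and \<open>(m, 0)\<close>; the exclusion of \<open>(1, 1)\<close> forces
    \<open>m\<close> to be at least 2, so that \<open>(1, 1)\<close> is a legitimate third
    vertex.\<close>
  consider "(k, n) \<noteq> (a, b)" "(k, n) \<noteq> (c, d)" | "k = c" "n = d"
    | "k = a" "n = b" "1 \<le> d" | "k = a" "n = b" "d = 0" "0 < k"
    | "k = a" "n = b" "d = 0" "k = 0" "0 < l" | "k = a" "n = b" "d = 0" "k = 0" "l = 0"
    by fastforce
  then show ?thesis
  proof cases
    case 1 with assms show ?thesis by (intro that[of k n]) (simp_all add: m n)
  next
    case 2 with assms show ?thesis by (intro that[of k l]) (simp_all add: m n)
  next
    case 3 with assms show ?thesis by (intro that[of k l]) (auto simp: m n)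
  next
    case 4 with assms show ?thesis by (intro that[of m 0]) (simp_all add: m n)
  next
    case 5 with assms show ?thesis by (intro that[of m 1]) (simp_all add: m n)
  next
    case 6 with assms show ?thesis by (intro that[of 1 1]) (simp_all add: m n)
  qed
qed

lemma integral_covering_graph_sep:
  assumes m: "1 \<le> m1" "1 \<le> m2" "(m1, m2) \<noteq> (1, 1)"
    and xy: "x \<in> covering_verts [m1, m2]" "y \<in> covering_verts [m1, m2]" "x \<noteq> y"
  shows "\<exists>z \<in> covering_verts [m1, m2] - {x, y}.
    (\<forall>i < length [m1, m2]. [m1, m2] ! i \<le> x ! i + z ! i) \<noteq>
    (\<forall>i < length [m1, m2]. [m1, m2] ! i \<le> y ! i + z ! i)"
proof -
  obtain a b where x: "x = [a, b]" "a \<le> m1" "b \<le> m2" "(a, b) \<noteq> (0, 0)" "(a, b) \<noteq> (m1, m2)"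
    using xy(1) covering_verts_pair by auto
  obtain c d where y: "y = [c, d]" "c \<le> m1" "d \<le> m2" "(c, d) \<noteq> (0, 0)" "(c, d) \<noteq> (m1, m2)"
    using xy(2) covering_verts_pair by auto
  have "\<exists>k l. k \<le> m1 \<and> l \<le> m2 \<and> (k, l) \<noteq> (0, 0) \<and> (k, l) \<noteq> (m1, m2) \<and>
    (k, l) \<noteq> (a, b) \<and> (k, l) \<noteq> (c, d) \<and>
    (m1 \<le> a + k \<and> m2 \<le> b + l) \<noteq> (m1 \<le> c + k \<and> m2 \<le> d + l)"
  proof -
    \<comment> \<open>Distinct vectors differ in some entry. Exchanging the vectors or the two
      coordinates reduces every case to a strict inequality in the first entry; the coordinate swap
      is why the last two cases bind the witness as \<open>l k\<close>.\<close>
    consider "a < c" | "c < a" | "b < d" | "d < b"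
      using x y xy(3) by force
    then show ?thesis
    proof cases
      case 1 show ?thesis
        apply (rule separating_pair[OF m 1 y(2) x(3) y(3) x(4) y(5)])
        subgoal for k l by (rule exI[of _ k], rule exI[of _ l]) simp
        done
    next
      case 2 show ?thesis
        apply (rule separating_pair[OF m 2 x(2) y(3) x(3) y(4) x(5)])
        subgoal for k l by (rule exI[of _ k], rule exI[of _ l]) simp
        done
    next
      case 3 show ?thesis
        apply (rule separating_pair[OF m(2,1) _ 3 y(3) x(2) y(2)])
        subgoal using m(3) by auto
        subgoal using x(4) by auto
        subgoal using y(5) by auto
        subgoal for l k by (rule exI[of _ k], rule exI[of _ l]) blast
        done
    next
      case 4 show ?thesis
        apply (rule separating_pair[OF m(2,1) _ 4 x(3) y(2) x(2)])
        subgoal using m(3) by auto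
        subgoal using y(4) by auto
        subgoal using x(5) by auto
        subgoal for l k by (rule exI[of _ k], rule exI[of _ l]) blast
        done
    qed
  qed
  then obtain k l where kl: "k \<le> m1" "l \<le> m2" "(k, l) \<noteq> (0, 0)" "(k, l) \<noteq> (m1, m2)"
    "(k, l) \<noteq> (a, b)" "(k, l) \<noteq> (c, d)"
    "(m1 \<le> a + k \<and> m2 \<le> b + l) \<noteq> (m1 \<le> c + k \<and> m2 \<le> d + l)"
    by blast
  have "[k, l] \<in> covering_verts [m1, m2] - {x, y}"
    using kl(1-6) by (simp add: covering_verts_pair x(1) y(1))
  moreover have "(\<forall>i < length [m1, m2]. [m1, m2] ! i \<le> v ! i + [k, l] ! i) \<longleftrightarrow>
      m1 \<le> v ! 0 + k \<and> m2 \<le> v ! 1 + l" for v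
    by (auto simp: less_Suc_eq)
  ultimately show ?thesis
    using kl(7) by (intro bexI[of _ "[k, l]"]) (simp_all add: x(1) y(1))
qed

section \<open>Capped multiplicities of primes in a domain\<close>

text \<open>The p-adic valuation truncated at \<open>m\<close>. The cap gives \<open>r = 0\<close>
  the value \<open>m\<close> and makes the value depend only on the residue of \<open>r\<close>
  modulo \<open>p^m\<close>.\<close>

definition capped_order :: "('a, 'b) ring_scheme \<Rightarrow> 'a \<Rightarrow> nat \<Rightarrow> 'a \<Rightarrow> nat" where
  "capped_order R p m r = Max {k. k \<le> m \<and> p [^]\<^bsub>R\<^esub> k divides\<^bsub>R\<^esub> r}"

context domain
begin

lemma pow_divides_pow:
  assumes "p \<in> carrier R" "i \<le> (j::nat)"
  shows "p [^] i divides p [^] j"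
  using assms nat_pow_mult[of p i "j - i"] by (intro dividesI[of "p [^] (j - i)"]) auto

lemma pow_nonzero:
  assumes "p \<in> carrier R" "p \<noteq> \<zero>"
  shows "p [^] (n::nat) \<noteq> \<zero>"
  using assms by (induction n) (auto simp: integral_iff)

text \<open>The admissible exponents form a downward closed set containing 0, so their maximum
  determines the set. Later questions about capped orders thereby become questions about
  divisibility.\<close>

lemma le_capped_order_iff:
  assumes "p \<in> carrier R" "r \<in> carrier R"
  shows "k \<le> capped_order R p m r \<longleftrightarrow> k \<le> m \<and> p [^] k divides r"
proof -
  let ?S = "{k. k \<le> m \<and> p [^] k divides r}"
  have fin: "finite ?S" by simp
  have "0 \<in> ?S" using assms by (auto intro: one_divides)
  then have "capped_order R p m r \<in> ?S" unfolding capped_order_def using fin Max_in by blast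
  then show ?thesis
    using assms pow_divides_pow[of p k "capped_order R p m r"] Max_ge[OF fin, of k]
    by (auto simp: capped_order_def intro: divides_trans)
qed

lemma capped_order_le:
  assumes "p \<in> carrier R" "r \<in> carrier R"
  shows "capped_order R p m r \<le> m"
  using le_capped_order_iff[OF assms, of "capped_order R p m r" m] by simp

lemma capped_order_dvd:
  assumes "p \<in> carrier R" "r \<in> carrier R"
  shows "p [^] capped_order R p m r divides r"
  using le_capped_order_iff[OF assms, of "capped_order R p m r" m] by simp

text \<open>For exponents up to \<open>m\<close>, adding a multiple of \<open>p^m\<close> does not
  change divisibility by a power of \<open>p\<close>. This is what makes the multiplicity vector
  well defined on cosets.\<close>

lemma capped_order_cong:
  assumes "p \<in> carrier R" "r \<in> carrier R" "s \<in> carrier R" "p [^] m divides (r \<ominus> s)"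
  shows "capped_order R p m r = capped_order R p m s"
proof -
  have aux: "p [^] k divides b" if "k \<le> m" "p [^] k divides a" "p [^] m divides c"
    "a \<in> carrier R" "b \<in> carrier R" "c \<in> carrier R" "b = a \<oplus> c" for k a b c
  proof -
    have "p [^] k divides c"
      using that assms(1) pow_divides_pow[of p k m] divides_trans by blast
    then obtain x y where "x \<in> carrier R" "y \<in> carrier R" "a = p [^] k \<otimes> x" "c = p [^] k \<otimes> y"
      using \<open>p [^] k divides a\<close> by (auto elim!: dividesE)
    then show ?thesis using assms(1) that by (intro dividesI[of "x \<oplus> y"]) (auto simp: r_distr)
  qed
  have neg: "p [^] m divides \<ominus> (r \<ominus> s)"
  proof -
    obtain x where "x \<in> carrier R" "r \<ominus> s = p [^] m \<otimes> x" using assms(4) by (auto elim: dividesE)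
    then show ?thesis using assms(1) by (intro dividesI[of "\<ominus> x"]) (auto simp: r_minus)
  qed
  have "r = s \<oplus> (r \<ominus> s)" "s = r \<oplus> \<ominus> (r \<ominus> s)"
    using assms(2,3) by (algebra, algebra)
  then have "k \<le> capped_order R p m r \<longleftrightarrow> k \<le> capped_order R p m s" for k
    using aux[of k r "\<ominus> (r \<ominus> s)" s] aux[of k s "r \<ominus> s" r] neg assms
    by (auto simp: le_capped_order_iff)
  then show ?thesis by (meson order_antisym order_refl)
qed

text \<open>Induction on the exponent: after cancelling the \<open>n\<close> factors already
  distributed, the remaining prime divides the product of the two cofactors, hence one of them, and
  that side absorbs it.\<close>

lemma prime_pow_divides_mult_split:
  assumes p: "p \<in> carrier R" "ring_prime p"
    and "r \<in> carrier R" "s \<in> carrier R" "p [^] (n::nat) divides r \<otimes> s"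
  obtains i j where "i + j = n" "p [^] i divides r" "p [^] j divides s"
proof -
  have "\<exists>i j. i + j = n \<and> p [^] i divides r \<and> p [^] j divides s"
    using assms(5)
  proof (induction n)
    case 0
    then show ?case using assms by (auto intro: one_divides)
  next
    case (Suc n)
    have "p [^] n divides r \<otimes> s"
      using Suc.prems pow_divides_pow[OF p(1), of n "Suc n"] p(1)
      by (meson divides_trans le_SucI nat_pow_closed order_refl)
    then obtain i j where ij: "i + j = n" "p [^] i divides r" "p [^] j divides s"
      using Suc.IH by auto
    then obtain x y where xy: "x \<in> carrier R" "y \<in> carrier R" "r = p [^] i \<otimes> x" "s = p [^] j \<otimes> y"
      by (auto elim!: dividesE)
    obtain z where z: "z \<in> carrier R" "r \<otimes> s = p [^] Suc n \<otimes> z"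
      using Suc.prems by (auto elim: dividesE)
    \<comment> \<open>Both sides are \<open>r \<otimes> s\<close>, written once with the cofactors
      and once with the extra factor \<open>p\<close>; cancelling \<open>p^n\<close> leaves
      \<open>x \<otimes> y = p \<otimes> z\<close>.\<close>
    have "p [^] n \<otimes> (x \<otimes> y) = (p [^] i \<otimes> p [^] j) \<otimes> (x \<otimes> y)"
      using p ij(1) by (simp add: nat_pow_mult)
    also have "\<dots> = r \<otimes> s" using p xy by (simp add: m_ac)
    also have "\<dots> = p [^] n \<otimes> (p \<otimes> z)" using p z by (simp add: m_ac)
    finally have "x \<otimes> y = p \<otimes> z"
      using p xy z ring_primeE(1)[OF p] by (subst (asm) m_lcancel) (auto simp: pow_nonzero)
    then have "p divides x \<otimes> y" using z by auto
    then have "p divides x \<or> p divides y"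
      using ring_primeE(3)[OF p] xy by (auto simp: prime_def)
    then show ?case
    proof
      assume "p divides x"
      then have "p [^] Suc i divides r"
        using p xy divides_mult_lI[of p x "p [^] i"] by simp
      then show ?thesis using ij by (intro exI[of _ "Suc i"] exI[of _ j]) auto
    next
      assume "p divides y"
      then have "p [^] Suc j divides s"
        using p xy divides_mult_lI[of p y "p [^] j"] by simp
      then show ?thesis using ij by (intro exI[of _ i] exI[of _ "Suc j"]) auto
    qed
  qed
  then show ?thesis using that by blast
qed

text \<open>Capping loses nothing here, because a splitting of the exponent \<open>m\<close> uses
  exponents at most \<open>m\<close> on both sides.\<close>

lemma prime_pow_divides_mult_iff:
  assumes p: "p \<in> carrier R" "ring_prime p" and rs: "r \<in> carrier R" "s \<in> carrier R"
  shows "p [^] m divides r \<otimes> s \<longleftrightarrow> m \<le> capped_order R p m r + capped_order R p m s"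
proof
  assume "p [^] m divides r \<otimes> s"
  then obtain i j where ij: "i + j = m" "p [^] i divides r" "p [^] j divides s"
    using prime_pow_divides_mult_split[OF p rs] by blast
  then have "i \<le> capped_order R p m r" "j \<le> capped_order R p m s"
    using p rs by (auto simp: le_capped_order_iff)
  then show "m \<le> capped_order R p m r + capped_order R p m s" using ij(1) by linarith
next
  let ?a = "capped_order R p m r" and ?b = "capped_order R p m s"
  assume "m \<le> ?a + ?b"
  obtain x y where xy: "x \<in> carrier R" "y \<in> carrier R" "r = p [^] ?a \<otimes> x" "s = p [^] ?b \<otimes> y"
    using capped_order_dvd[OF p(1) rs(1)] capped_order_dvd[OF p(1) rs(2)]
    by (meson dividesE)
  have "r \<otimes> s = (p [^] ?a \<otimes> x) \<otimes> (p [^] ?b \<otimes> y)" using xy(3,4) by simp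
  also have "\<dots> = (p [^] ?a \<otimes> p [^] ?b) \<otimes> (x \<otimes> y)"
    using p(1) xy(1,2) by (simp add: m_ac)
  finally have "p [^] (?a + ?b) divides r \<otimes> s"
    using p xy(1,2) by (auto simp: nat_pow_mult)
  then show "p [^] m divides r \<otimes> s"
    using pow_divides_pow[OF p(1) \<open>m \<le> ?a + ?b\<close>] p(1) divides_trans by blast
qed

lemma prime_divides_pow:
  assumes "p \<in> carrier R" "ring_prime p" "q \<in> carrier R" "p divides q [^] (n::nat)"
  shows "p divides q"
  using assms(4)
proof (induction n)
  case 0
  then show ?case using ring_primeE(3)[OF assms(1,2)] assms(1)
    by (auto simp: prime_def divides_one)
next
  case (Suc n)
  then show ?case using ring_primeE(3)[OF assms(1,2)] assms(3) by (auto simp: prime_def)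
qed

lemma prime_divides_primeD:
  assumes p: "p \<in> carrier R" "ring_prime p" and q: "q \<in> carrier R" "ring_prime q"
    and "p divides q"
  shows "p \<sim> q"
proof -
  obtain c where c: "c \<in> carrier R" "q = p \<otimes> c" using assms(5) by (auto elim: dividesE)
  have "q divides p \<otimes> c" using c q by simp
  then consider "q divides p" | "q divides c"
    using ring_primeE(3)[OF q] p(1) c(1) unfolding prime_def by blast
  then show ?thesis
  proof cases
    case 1 then show ?thesis using assms(5) by (simp add: associated_def)
  next
    case 2
    then obtain d where d: "d \<in> carrier R" "c = q \<otimes> d" by (auto elim: dividesE)
    \<comment> \<open>If \<open>q\<close> divided the cofactor \<open>c\<close>, cancelling
      \<open>q\<close> would make \<open>p\<close> a unit.\<close>
    have "q \<otimes> \<one> = q \<otimes> (p \<otimes> d)" using c d p q by (metis m_lcomm r_one)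
    then have "\<one> = p \<otimes> d" using p q d ring_primeE(1)[OF q] by (subst (asm) m_lcancel) auto
    then have "p divides \<one>" using d by auto
    then show ?thesis using ring_primeE(3)[OF p] p by (simp add: prime_def divides_one)
  qed
qed

text \<open>For the converse, write \<open>x\<close> as \<open>p^a\<close> times \<open>y\<close>
  and distribute the factors of \<open>q^b\<close> over this product. As \<open>q\<close> does not
  divide \<open>p^a\<close>, all of them fall on \<open>y\<close>.\<close>

lemma prime_pow_mult_divides_iff:
  assumes p: "p \<in> carrier R" "ring_prime p" and q: "q \<in> carrier R" "ring_prime q"
    and "\<not> p \<sim> q" and x: "x \<in> carrier R"
  shows "p [^] (a::nat) \<otimes> q [^] (b::nat) divides x \<longleftrightarrow> p [^] a divides x \<and> q [^] b divides x"
proof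
  assume *: "p [^] a \<otimes> q [^] b divides x"
  have "p [^] a divides p [^] a \<otimes> q [^] b" "q [^] b divides p [^] a \<otimes> q [^] b"
    using p q by (auto intro: divides_prod_l)
  then show "p [^] a divides x \<and> q [^] b divides x"
    using * p q by (meson divides_trans nat_pow_closed)
next
  assume *: "p [^] a divides x \<and> q [^] b divides x"
  then obtain y where y: "y \<in> carrier R" "x = p [^] a \<otimes> y" by (auto elim: dividesE)
  have "\<not> q divides p [^] a"
    using prime_divides_pow[OF q p(1)] prime_divides_primeD[OF q p] assms(5) p q
    by (auto intro: associated_sym)
  moreover obtain i j where ij: "i + j = b" "q [^] i divides p [^] a" "q [^] j divides y"
    using * y p q prime_pow_divides_mult_split[OF q, of "p [^] a" y b] by auto
  moreover have "q divides q [^] i" if "i \<noteq> 0"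
    using q(1) that pow_divides_pow[of q 1 i] by simp
  ultimately have "i = 0" using q(1) divides_trans by blast
  then have "q [^] b divides y" using ij by simp
  then show "p [^] a \<otimes> q [^] b divides x"
    using y p q by (auto intro: divides_mult_lI)
qed

text \<open>Serves to realise any prescribed pair of multiplicities by a product of prime
  powers.\<close>

lemma capped_order_prime_pow_mult:
  assumes p: "p \<in> carrier R" "ring_prime p" and c: "c \<in> carrier R" "\<not> p divides c" and "a \<le> m"
  shows "capped_order R p m (p [^] a \<otimes> c) = a"
proof (rule antisym)
  show "a \<le> capped_order R p m (p [^] a \<otimes> c)"
    using assms by (auto simp: le_capped_order_iff)
  have "\<not> p [^] Suc a divides p [^] a \<otimes> c"
  proof
    assume "p [^] Suc a divides p [^] a \<otimes> c"
    then obtain y where y: "y \<in> carrier R" "p [^] a \<otimes> c = p [^] a \<otimes> (p \<otimes> y)"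
      using p by (auto elim: dividesE simp: m_assoc)
    then have "c = p \<otimes> y"
      using p c ring_primeE(1)[OF p] by (subst (asm) m_lcancel) (auto simp: pow_nonzero)
    then show False using c(2) y(1) by auto
  qed
  then have "\<not> Suc a \<le> capped_order R p m (p [^] a \<otimes> c)"
    using p c by (simp add: le_capped_order_iff del: nat_pow_Suc)
  then show "capped_order R p m (p [^] a \<otimes> c) \<le> a" by simp
qed

section \<open>The zero divisor graph of the quotient ring\<close>

lemma twin_quotient_zero_divisor_graph_iso:
  assumes p1: "p1 \<in> carrier R" "ring_prime p1" and p2: "p2 \<in> carrier R" "ring_prime p2"
    and nassoc: "\<not> p1 \<sim> p2" and m: "1 \<le> m1" "1 \<le> m2" "(m1, m2) \<noteq> (1, 1)"
    and I_h: "I = PIdl (p1 [^] (m1::nat) \<otimes> p2 [^] (m2::nat))"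
  shows "ugraph_iso (twin_quotient (zero_divisor_graph (R Quot I)))
    (integral_covering_graph [m1, m2])"
proof -
  let ?h = "p1 [^] m1 \<otimes> p2 [^] m2"
  have hc: "?h \<in> carrier R" using p1 p2 by simp
  define Q where "Q = R Quot I"
  have ideal: "ideal I R" unfolding I_h using hc by (rule cgenideal_ideal)
  interpret I: ideal I R by (rule ideal)
  interpret Q: cring Q unfolding Q_def by (rule I.quotient_is_cring) (rule is_cring)
  have in_I: "x \<in> I \<longleftrightarrow> p1 [^] m1 divides x \<and> p2 [^] m2 divides x" if "x \<in> carrier R" for x
  proof -
    have "x \<in> I \<longleftrightarrow> ?h divides x"
      unfolding I_h cgenideal_def factor_def using hc that by (auto simp: m_comm)
    then show ?thesis using prime_pow_mult_divides_iff[OF p1 p2 nassoc that] by simp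
  qed
  define \<nu> where "\<nu> r = [capped_order R p1 m1 r, capped_order R p2 m2 r]" for r
  \<comment> \<open>The choice of representative is harmless by \<open>\<nu>_cong\<close>. The
    relation \<open>P\<close> below is adjacency in the covering graph without the distinctness
    condition, so that it also describes products within a fibre.\<close>
  define \<phi> where "\<phi> C = \<nu> (SOME r. r \<in> C)" for C
  define P where "P x y \<longleftrightarrow> (\<forall>i < length [m1, m2]. [m1, m2] ! i \<le> x ! i + y ! i)" for x y :: "nat list"
  have P_pair: "P [a, b] [c, d] \<longleftrightarrow> m1 \<le> a + c \<and> m2 \<le> b + d" for a b c d
    by (auto simp: P_def less_Suc_eq)
  have \<nu>_cong: "\<nu> r = \<nu> s" if "I +> r = I +> s" "r \<in> carrier R" "s \<in> carrier R" for r s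
  proof -
    have "r \<ominus> s \<in> I" using quotient_eq_iff_same_a_r_cos[OF ideal] that by blast
    then have "p1 [^] m1 divides (r \<ominus> s)" "p2 [^] m2 divides (r \<ominus> s)"
      using in_I[of "r \<ominus> s"] that(2,3) by blast+
    then have "capped_order R p1 m1 r = capped_order R p1 m1 s"
      "capped_order R p2 m2 r = capped_order R p2 m2 s"
      using capped_order_cong[OF _ that(2,3)] p1(1) p2(1) by blast+
    then show ?thesis by (simp only: \<nu>_def)
  qed
  have \<phi>: "\<phi> (I +> r) = \<nu> r" if "r \<in> carrier R" for r
  proof -
    have "(SOME s. s \<in> I +> r) \<in> I +> r" using I.a_rcos_self[OF that] by (rule someI)
    then show ?thesis
      unfolding \<phi>_def using that I.a_repr_independence' I.a_elemrcos_carrier \<nu>_cong by metis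
  qed
  have zero: "I +> r = \<zero>\<^bsub>Q\<^esub> \<longleftrightarrow> r \<in> I" if "r \<in> carrier R" for r
    using that ideal a_rcos_zero I.rcos_const_imp_mem by (auto simp: Q_def FactRing_def)
  have carrier_Q: "carrier Q = (+>) I ` carrier R"
    by (auto simp: Q_def FactRing_def A_RCOSETS_def')
  have mult_Q: "(I +> r) \<otimes>\<^bsub>Q\<^esub> (I +> s) = I +> r \<otimes> s" if "r \<in> carrier R" "s \<in> carrier R" for r s
    using that I.rcoset_mult_add by (simp add: Q_def FactRing_def)
  have P_iff: "C \<otimes>\<^bsub>Q\<^esub> D = \<zero>\<^bsub>Q\<^esub> \<longleftrightarrow> P (\<phi> C) (\<phi> D)" if CD: "C \<in> carrier Q" "D \<in> carrier Q" for C D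
  proof -
    obtain r s where rs: "r \<in> carrier R" "s \<in> carrier R" "C = I +> r" "D = I +> s"
      using CD unfolding carrier_Q by blast
    have "C \<otimes>\<^bsub>Q\<^esub> D = \<zero>\<^bsub>Q\<^esub> \<longleftrightarrow> p1 [^] m1 divides r \<otimes> s \<and> p2 [^] m2 divides r \<otimes> s"
      using rs mult_Q[of r s] zero[of "r \<otimes> s"] in_I[of "r \<otimes> s"] by simp
    also have "\<dots> \<longleftrightarrow> P (\<phi> C) (\<phi> D)"
      unfolding rs(3,4) \<phi>[OF rs(1)] \<phi>[OF rs(2)] \<nu>_def P_pair
        prime_pow_divides_mult_iff[OF p1 rs(1,2)] prime_pow_divides_mult_iff[OF p2 rs(1,2)] ..
    finally show ?thesis .
  qed
  have \<phi>_range: "\<exists>a b. \<phi> C = [a, b] \<and> a \<le> m1 \<and> b \<le> m2" if "C \<in> carrier Q" for C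
    using that p1 p2 unfolding carrier_Q by (auto simp: \<phi> \<nu>_def capped_order_le)
  have \<phi>_top: "\<phi> C = [m1, m2] \<longleftrightarrow> C = \<zero>\<^bsub>Q\<^esub>" if C: "C \<in> carrier Q" for C
  proof -
    obtain r where r: "r \<in> carrier R" "C = I +> r" using C unfolding carrier_Q by blast
    have "\<phi> C = [m1, m2] \<longleftrightarrow> m1 \<le> capped_order R p1 m1 r \<and> m2 \<le> capped_order R p2 m2 r"
      using r p1 p2 capped_order_le[of p1 r m1] capped_order_le[of p2 r m2]
      by (auto simp: \<phi> \<nu>_def)
    also have "\<dots> \<longleftrightarrow> C = \<zero>\<^bsub>Q\<^esub>"
      unfolding r(2) zero[OF r(1)] in_I[OF r(1)]
        le_capped_order_iff[OF p1(1) r(1)] le_capped_order_iff[OF p2(1) r(1)] by blast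
    finally show ?thesis .
  qed
  \<comment> \<open>The coset of \<open>p1^a\<close> times \<open>p2^b\<close> has the vector
    \<open>[a, b]\<close>, since neither prime divides a power of the other.\<close>
  have \<phi>_surj: "\<exists>C \<in> carrier Q. \<phi> C = [a, b]" if "a \<le> m1" "b \<le> m2" for a b
  proof -
    have "\<not> p1 divides p2 [^] b" "\<not> p2 divides p1 [^] a"
      using prime_divides_pow prime_divides_primeD p1 p2 nassoc associated_sym by blast+
    then have "\<nu> (p1 [^] a \<otimes> p2 [^] b) = [a, b]"
      using p1 p2 that capped_order_prime_pow_mult[OF p1, of "p2 [^] b" a m1]
        capped_order_prime_pow_mult[OF p2, of "p1 [^] a" b m2]
      by (simp add: \<nu>_def m_comm[of "p1 [^] a"])
    then show ?thesis using p1 p2 \<phi>[of "p1 [^] a \<otimes> p2 [^] b"] carrier_Q by auto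
  qed
  \<comment> \<open>The two vectors removed from the box have ring-theoretic meaning: the top one
    belongs to the zero of \<open>Q\<close>, and the zero vector to the elements that are not zero
    divisors. An annihilator of an element with zero vector must have the top vector; otherwise the
    complementary vector \<open>[m1 - a, m2 - b]\<close> supplies a nonzero annihilator.\<close>
  have zd: "C \<in> zero_divs Q - {\<zero>\<^bsub>Q\<^esub>} \<longleftrightarrow> C \<in> carrier Q \<and> \<phi> C \<in> covering_verts [m1, m2]" for C
  proof (cases "C \<in> carrier Q")
    case True
    obtain a b where ab: "\<phi> C = [a, b]" "a \<le> m1" "b \<le> m2" using \<phi>_range[OF True] by auto
    have "C \<in> zero_divs Q \<longleftrightarrow> (a, b) \<noteq> (0, 0)"
    proof
      assume "C \<in> zero_divs Q"
      then obtain D where D: "D \<in> carrier Q" "D \<noteq> \<zero>\<^bsub>Q\<^esub>" "P (\<phi> C) (\<phi> D)"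
        using True P_iff by (auto simp: zero_divs_def)
      then show "(a, b) \<noteq> (0, 0)"
        using ab \<phi>_range[OF D(1)] \<phi>_top[OF D(1)]
        by (auto simp: P_pair)
    next
      assume nz: "(a, b) \<noteq> (0, 0)"
      obtain D where D: "D \<in> carrier Q" "\<phi> D = [m1 - a, m2 - b]"
        using \<phi>_surj[of "m1 - a" "m2 - b"] by auto
      have "\<phi> D \<noteq> [m1, m2]" using nz ab m by (auto simp: D(2))
      then have "D \<noteq> \<zero>\<^bsub>Q\<^esub>" using \<phi>_top[OF D(1)] by blast
      moreover have "C \<otimes>\<^bsub>Q\<^esub> D = \<zero>\<^bsub>Q\<^esub>"
        unfolding P_iff[OF True D(1)] D(2) ab(1) P_pair using ab by simp
      ultimately show "C \<in> zero_divs Q"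
        using D(1) True unfolding zero_divs_def by blast
    qed
    then show ?thesis
      using True ab \<phi>_top[OF True] by (auto simp: covering_verts_pair)
  qed (auto simp: zero_divs_def)
  let ?G = "zero_divisor_graph Q" and ?H = "integral_covering_graph [m1, m2]"
  have verts: "verts ?G = {C \<in> carrier Q. \<phi> C \<in> covering_verts [m1, m2]}"
    "verts ?H = covering_verts [m1, m2]"
    using zd by (auto simp: zero_divisor_graph_def integral_covering_graph_def)
  have "ugraph_iso (twin_quotient ?G) ?H"
  proof (rule twin_quotient_iso)
    show "\<phi> ` verts ?G = verts ?H"
    proof
      show "\<phi> ` verts ?G \<subseteq> verts ?H" unfolding verts by blast
      show "verts ?H \<subseteq> \<phi> ` verts ?G"
      proof
        fix x
        assume x: "x \<in> verts ?H"
        then obtain a b where "x = [a, b]" "a \<le> m1" "b \<le> m2"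
          unfolding verts covering_verts_pair by blast
        then obtain C where "C \<in> carrier Q" "\<phi> C = x" using \<phi>_surj by blast
        then show "x \<in> \<phi> ` verts ?G" using x unfolding verts by blast
      qed
    qed
    show "{C, D} \<in> edges ?G \<longleftrightarrow> C \<noteq> D \<and> P (\<phi> C) (\<phi> D)"
      if "C \<in> verts ?G" "D \<in> verts ?G" for C D
    proof -
      have CD: "C \<in> carrier Q" "D \<in> carrier Q" using that unfolding verts by blast+
      \<comment> \<open>The edge set may list the pair in either order, so commutativity of
        \<open>Q\<close> enters; symmetry of \<open>P\<close> plays the same role for the covering
        graph.\<close>
      have "{C, D} \<in> edges ?G \<longleftrightarrow> C \<noteq> D \<and> C \<otimes>\<^bsub>Q\<^esub> D = \<zero>\<^bsub>Q\<^esub>"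
        using that Q.m_comm[OF CD] unfolding zero_divisor_graph_def
        by (simp add: doubleton_eq_iff) metis
      then show ?thesis unfolding P_iff[OF CD] .
    qed
    show "{x, y} \<in> edges ?H \<longleftrightarrow> x \<noteq> y \<and> P x y" if "x \<in> verts ?H" "y \<in> verts ?H" for x y
    proof -
      have "P x y \<longleftrightarrow> P y x" for x y by (simp only: P_def add.commute)
      moreover have "edges ?H = {{v, w} |v w. v \<in> verts ?H \<and> w \<in> verts ?H \<and> v \<noteq> w \<and> P v w}"
        by (simp only: integral_covering_graph_def P_def ugraph.simps)
      ultimately show ?thesis using that by (auto simp: doubleton_eq_iff)
    qed
    show "\<exists>z \<in> verts ?H - {x, y}. P x z \<noteq> P y z"
      if "x \<in> verts ?H" "y \<in> verts ?H" "x \<noteq> y" for x y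
      using integral_covering_graph_sep[OF m] that unfolding verts P_def by blast
  qed
  then show ?thesis unfolding Q_def .
qed

end

theorem corollary74:
  fixes R :: "('a, 'b) ring_scheme" and I :: "'a set"
    and g u p1 p2 :: 'a and m1 m2 :: nat
  assumes "principal_domain R"
    and "g \<in> carrier R"
    and "I = PIdl\<^bsub>R\<^esub> g"
    and "I \<subset> carrier R"
    and "\<not> primeideal I R"
    and "finite (carrier (R Quot I))"
    and "u \<in> Units R"
    and "p1 \<in> carrier R" and "ring_prime\<^bsub>R\<^esub> p1"
    and "p2 \<in> carrier R" and "ring_prime\<^bsub>R\<^esub> p2"
    and "\<not> p1 \<sim>\<^bsub>R\<^esub> p2"
    and "1 \<le> m1" and "1 \<le> m2"
    and "g = u \<otimes>\<^bsub>R\<^esub> (p1 [^]\<^bsub>R\<^esub> m1 \<otimes>\<^bsub>R\<^esub> p2 [^]\<^bsub>R\<^esub> m2)"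
    and "[m1, m2] \<noteq> [1, 1]"
  shows "ugraph_iso (twin_quotient (zero_divisor_graph (R Quot I)))
           (integral_covering_graph [m1, m2])"
proof -
  interpret principal_domain R by fact
  let ?h = "p1 [^]\<^bsub>R\<^esub> m1 \<otimes>\<^bsub>R\<^esub> p2 [^]\<^bsub>R\<^esub> m2"
  have h: "?h \<in> carrier R" using assms(8,10) by simp
  \<comment> \<open>The unit \<open>u\<close> changes the generator only up to association, hence
    not the ideal.\<close>
  have "g \<sim>\<^bsub>R\<^esub> ?h"
    using assms(2,7,15) h by (metis Units_closed associatedI2' m_comm)
  then have "I = PIdl\<^bsub>R\<^esub> ?h" using assms(2,3) h associated_iff_same_ideal by simp
  with assms show ?thesis by (intro twin_quotient_zero_divisor_graph_iso) auto
qed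

end
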